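(* Let $k\ge 1$ be an integer and $0<\epsilon<1$. For $t\in\mathbb{R}$ let $I(t)=\langle z_1^k-\epsilon e^{it}\rangle\subseteq\mathbb{C}[z_1,z_2]$, let $I(t)^\perp$ be its orthogonal complement in $H^2_2$, and let $$\mathcal{I}^\perp=\{(t,\xi): t\in\mathbb{R},\ \xi\in I(t)^\perp\}\subseteq \mathbb{R}\times H^2_2$$ with the subspace topology. Then the map $p:\mathcal{I}^\perp\to\mathbb{R}$, $p(t,\xi)=t$, defines a smooth bundle of Hilbert spaces over $\mathbb{R}$, and therefore (since $I(t+2\pi)=I(t)$) also over the circle $\mathbb{S}^1:=\mathbb{R}/2\pi\mathbb{Z}$.
   Context: $H^2_2$ is the Drury-Arveson space on the unit ball $\mathbb{B}^2\subset\mathbb{C}^2$: the Hilbert space of analytic functions $\sum_{m,n\ge0}x_{m,n}z_1^mz_2^n$ on $\mathbb{B}^2$ in which distinct monomials are orthogonal and $\|z_1^mz_2^n\|^2=\omega_{m,n}:=\binom{m+n}{m}^{-1}$. $\langle z_1^k-\epsilon e^{it}\rangle$ denotes the principal ideal generated by $z_1^k-\epsilon e^{it}$. A smooth bundle of Hilbert spaces is a (topological) vector bundle whose fibers are Hilbert spaces, i.e. admitting local trivializations over open sets of the base that are fiberwise linear homeomorphisms onto (open set) $\times$ (fixed Hilbert space) commuting with the projections, together with a smooth structure given by an atlas of such trivializations with smooth transition maps. *)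

theory Defs
  imports
    "HOL-Analysis.Analysis"
    "HOL-Computational_Algebra.Polynomial"
begin

section \<open>Complex Hilbert spaces\<close>

text \<open>The norm is the one of \<^class>\<open>real_inner\<close> for the real part of the Hermitian product, so that
  \<open>(norm x)\<^sup>2 = cinner x x\<close>. The product is linear in its first argument.\<close>

class complex_hilbert = real_inner + complete_space +
  fixes scaleC :: "complex \<Rightarrow> 'a \<Rightarrow> 'a"  (infixr \<open>*\<^sub>C\<close> 75)
    and cinner :: "'a \<Rightarrow> 'a \<Rightarrow> complex"
  assumes scaleC_add_right: "a *\<^sub>C (x + y) = a *\<^sub>C x + a *\<^sub>C y"
    and scaleC_add_left: "(a + b) *\<^sub>C x = a *\<^sub>C x + b *\<^sub>C x"
    and scaleC_scaleC: "a *\<^sub>C b *\<^sub>C x = (a * b) *\<^sub>C x"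
    and scaleC_of_real: "of_real r *\<^sub>C x = r *\<^sub>R x"
    and cinner_commute: "cinner x y = cnj (cinner y x)"
    and cinner_add_left: "cinner (x + y) z = cinner x z + cinner y z"
    and cinner_scaleC_left: "cinner (a *\<^sub>C x) y = a * cinner x y"
    and Re_cinner: "Re (cinner x y) = inner x y"

subclass (in complex_hilbert) banach ..

definition closed_csubspace :: "'a::complex_hilbert set \<Rightarrow> bool" where
  "closed_csubspace S \<longleftrightarrow>
     closed S \<and> 0 \<in> S \<and> (\<forall>x\<in>S. \<forall>y\<in>S. x + y \<in> S) \<and> (\<forall>a. \<forall>x\<in>S. a *\<^sub>C x \<in> S)"

definition orthogonal_complement :: "'a::complex_hilbert set \<Rightarrow> 'a set" where
  "orthogonal_complement S = {\<xi>. \<forall>\<eta>\<in>S. cinner \<eta> \<xi> = 0}"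


section \<open>Smooth bundles of Hilbert spaces\<close>

text \<open>\<open>smooth_on S f\<close> says that \<open>f\<close> is of class \<open>C\<^sup>\<infinity>\<close> on \<open>S\<close>, where \<open>S\<close> is meant to be a
  relatively open subset of a closed subspace \<open>W\<close> of a Banach space: \<open>f\<close> is Frechet differentiable
  on \<open>S\<close> and all the directional derivatives \<open>x \<mapsto> Df(x)v\<close> are again smooth. Although the higher
  derivatives are differentiated in fixed directions, this is the usual notion for functions between
  Banach spaces: by the uniform boundedness principle the multilinear maps \<open>D\<^sup>n f(x)\<close> are bounded,
  locally uniformly in \<open>x\<close>, so each \<open>D\<^sup>n f\<close> is locally Lipschitz, and hence differentiable, in operator
  norm. In directions outside \<open>W\<close> the derivative within \<open>S\<close> is arbitrary.\<close>

coinductive smooth_on :: "'a::real_normed_vector set \<Rightarrow> ('a \<Rightarrow> 'b::real_normed_vector) \<Rightarrow> bool"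
  for S where
  "(\<And>x. x \<in> S \<Longrightarrow> (f has_derivative f' x) (at x within S)) \<Longrightarrow>
   (\<And>v. smooth_on S (\<lambda>x. f' x v)) \<Longrightarrow> smooth_on S f"

text \<open>A chart of a manifold consists of its domain and a map into the model space that is
  relevant only on this domain.\<close>

type_synonym ('b, 'm) chart = "'b set \<times> ('b \<Rightarrow> 'm)"

definition smooth_atlas ::
  "('b::topological_space, 'm::real_normed_vector) chart set \<Rightarrow> bool" where
  "smooth_atlas C \<longleftrightarrow>
     (\<Union>(X, \<kappa>)\<in>C. X) = UNIV \<and>
     (\<forall>(X, \<kappa>)\<in>C. open X \<and> open (\<kappa> ` X) \<and>
        homeomorphic_map (top_of_set X) (top_of_set (\<kappa> ` X)) \<kappa>) \<and>
     (\<forall>(X, \<kappa>)\<in>C. \<forall>(Y, \<kappa>')\<in>C. smooth_on (\<kappa> ` (X \<inter> Y)) (\<kappa>' \<circ> inv_into X \<kappa>))"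

text \<open>The Hilbert space structure of the fibers of a projection \<open>p\<close> from a topological space \<open>T\<close> is
  given by a map \<open>vect\<close> that identifies each fiber, homeomorphically, with a closed subspace of a
  Hilbert space.\<close>

definition fiber :: "'e topology \<Rightarrow> ('e \<Rightarrow> 'b) \<Rightarrow> 'b \<Rightarrow> 'e set" where
  "fiber T p b = {e \<in> topspace T. p e = b}"

definition hilbert_fibers ::
  "'e topology \<Rightarrow> ('e \<Rightarrow> 'b) \<Rightarrow> ('e \<Rightarrow> 'h::complex_hilbert) \<Rightarrow> bool" where
  "hilbert_fibers T p vect \<longleftrightarrow>
     (\<forall>b. closed_csubspace (vect ` fiber T p b) \<and>
        homeomorphic_map (subtopology T (fiber T p b)) (top_of_set (vect ` fiber T p b)) vect)"

definition local_trivialization ::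
  "'e topology \<Rightarrow> ('e \<Rightarrow> 'b::topological_space) \<Rightarrow> ('e \<Rightarrow> 'h::complex_hilbert) \<Rightarrow> 'h set
   \<Rightarrow> 'b set \<Rightarrow> ('e \<Rightarrow> 'b \<times> 'h) \<Rightarrow> bool" where
  "local_trivialization T p vect F U \<phi> \<longleftrightarrow>
     open U \<and>
     homeomorphic_map (subtopology T (p -` U)) (top_of_set (U \<times> F)) \<phi> \<and>
     (\<forall>e \<in> topspace T \<inter> p -` U. fst (\<phi> e) = p e) \<and>
     (\<forall>b\<in>U. \<forall>e\<in>fiber T p b. \<forall>e1\<in>fiber T p b. \<forall>e2\<in>fiber T p b. \<forall>a.
        vect e = a *\<^sub>C vect e1 + vect e2 \<longrightarrow> snd (\<phi> e) = a *\<^sub>C snd (\<phi> e1) + snd (\<phi> e2))"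

definition transition_map ::
  "'e topology \<Rightarrow> ('e \<Rightarrow> 'b) \<Rightarrow> 'b set \<Rightarrow> ('e \<Rightarrow> 'b \<times> 'h) \<Rightarrow> ('e \<Rightarrow> 'b \<times> 'h) \<Rightarrow> 'b \<times> 'h \<Rightarrow> 'b \<times> 'h" where
  "transition_map T p U \<phi> \<psi> = \<psi> \<circ> inv_into (topspace T \<inter> p -` U) \<phi>"

text \<open>The transition map \<open>\<psi> \<circ> \<phi>\<inverse>\<close> on \<open>(U \<inter> V) \<times> F\<close> is read in a chart of the base. The model
  fiber \<open>F\<close> may be taken inside the same Hilbert space \<open>'h\<close> as the fibers, being isomorphic to
  each of them.\<close>

definition smooth_hilbert_bundle_atlas ::
  "('b::topological_space, 'm::real_normed_vector) chart set \<Rightarrow> 'e topology \<Rightarrow> ('e \<Rightarrow> 'b)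
   \<Rightarrow> ('e \<Rightarrow> 'h::complex_hilbert) \<Rightarrow> 'h set \<Rightarrow> ('b set \<times> ('e \<Rightarrow> 'b \<times> 'h)) set \<Rightarrow> bool" where
  "smooth_hilbert_bundle_atlas C T p vect F A \<longleftrightarrow>
     (\<Union>(U, \<phi>)\<in>A. U) = UNIV \<and>
     (\<forall>(U, \<phi>)\<in>A. local_trivialization T p vect F U \<phi>) \<and>
     (\<forall>(U, \<phi>)\<in>A. \<forall>(V, \<psi>)\<in>A. \<forall>(X, \<kappa>)\<in>C.
        smooth_on ((\<kappa> ` (U \<inter> V \<inter> X)) \<times> F)
          (map_prod \<kappa> id \<circ> transition_map T p U \<phi> \<psi> \<circ> map_prod (inv_into X \<kappa>) id))"

definition smooth_hilbert_bundle ::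
  "('b::topological_space, 'm::real_normed_vector) chart set \<Rightarrow> 'e topology \<Rightarrow> ('e \<Rightarrow> 'b)
   \<Rightarrow> ('e \<Rightarrow> 'h::complex_hilbert) \<Rightarrow> bool" where
  "smooth_hilbert_bundle C T p vect \<longleftrightarrow>
     smooth_atlas C \<and> continuous_map T euclidean p \<and> hilbert_fibers T p vect \<and>
     (\<exists>F A. closed_csubspace F \<and> smooth_hilbert_bundle_atlas C T p vect F A)"


section \<open>The line and the circle\<close>

definition line_charts :: "(real, real) chart set" where
  "line_charts = {(UNIV, id)}"

definition circle_rel :: "real \<Rightarrow> real \<Rightarrow> bool" where
  "circle_rel s t \<longleftrightarrow> (\<exists>n::int. t = s + 2 * pi * of_int n)"

lemma equivp_circle_rel: "equivp circle_rel"
proof (rule equivpI)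
  show "reflp circle_rel"
    by (auto simp: reflp_def circle_rel_def intro!: exI[of _ 0])
  show "symp circle_rel"
    unfolding symp_def circle_rel_def
  proof clarify
    fix s :: real and n :: int
    show "\<exists>m::int. s = s + 2 * pi * of_int n + 2 * pi * of_int m"
      by (rule exI[of _ "-n"]) simp
  qed
  show "transp circle_rel"
    unfolding transp_def circle_rel_def
  proof clarify
    fix s :: real and n m :: int
    show "\<exists>l::int. s + 2 * pi * of_int n + 2 * pi * of_int m = s + 2 * pi * of_int l"
      by (rule exI[of _ "n + m"]) (simp add: algebra_simps)
  qed
qed

quotient_type circle = real / circle_rel
  by (rule equivp_circle_rel)

instantiation circle :: topological_space
begin

definition open_circle :: "circle set \<Rightarrow> bool" where
  "open_circle U \<longleftrightarrow> open (abs_circle -` U)"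

instance
  by standard (auto simp: open_circle_def vimage_Union)

end

definition circle_charts :: "(circle, real) chart set" where
  "circle_charts =
     {(abs_circle ` {a<..<a + 2 * pi}, inv_into {a<..<a + 2 * pi} abs_circle) | a. True}"


section \<open>The Drury-Arveson space\<close>

definition da_weight :: "nat \<times> nat \<Rightarrow> real" where
  "da_weight i = 1 / real ((fst i + snd i) choose (fst i))"

definition da_seq :: "(nat \<times> nat \<Rightarrow> complex) set" where
  "da_seq = {x. (\<lambda>i. da_weight i * (cmod (x i))\<^sup>2) summable_on UNIV}"

definition monomial :: "nat \<times> nat \<Rightarrow> complex \<times> complex \<Rightarrow> complex" where
  "monomial i z = fst z ^ fst i * snd z ^ snd i"

text \<open>Functions on the unit ball are represented by functions that vanish off the ball.\<close>

definition da_fun :: "(nat \<times> nat \<Rightarrow> complex) \<Rightarrow> complex \<times> complex \<Rightarrow> complex" where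
  "da_fun x z = (if z \<in> ball 0 1 then \<Sum>\<^sub>\<infinity>i. x i * monomial i z else 0)"

lemma da_weight_pos: "da_weight i > 0"
  by (simp add: da_weight_def)

lemma da_seq_bound:
  assumes "a \<ge> 0" "x \<in> da_seq" "y \<in> da_seq"
    and "\<And>i. (cmod (z i))\<^sup>2 \<le> a * ((cmod (x i))\<^sup>2 + (cmod (y i))\<^sup>2)"
  shows "z \<in> da_seq"
  unfolding da_seq_def mem_Collect_eq
proof (rule summable_on_comparison_test)
  show "(\<lambda>i. a * (da_weight i * (cmod (x i))\<^sup>2 + da_weight i * (cmod (y i))\<^sup>2)) summable_on UNIV"
    using assms(2,3) by (intro summable_on_cmult_right summable_on_add) (auto simp: da_seq_def)
  show "da_weight i * (cmod (z i))\<^sup>2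
        \<le> a * (da_weight i * (cmod (x i))\<^sup>2 + da_weight i * (cmod (y i))\<^sup>2)" for i
    using mult_left_mono[OF assms(4)[of i], of "da_weight i"] da_weight_pos[of i]
    by (simp add: algebra_simps)
  show "0 \<le> da_weight i * (cmod (z i))\<^sup>2" for i
    using da_weight_pos[of i] by simp
qed

lemma da_seq_0: "(\<lambda>_. 0) \<in> da_seq"
  by (simp add: da_seq_def)

lemma power2_cmod_add_le: "(cmod (a + b))\<^sup>2 \<le> 2 * ((cmod a)\<^sup>2 + (cmod b)\<^sup>2)"
proof -
  have "(cmod (a + b))\<^sup>2 \<le> (cmod a + cmod b)\<^sup>2"
    by (intro power_mono norm_triangle_ineq) auto
  also have "\<dots> \<le> 2 * ((cmod a)\<^sup>2 + (cmod b)\<^sup>2)"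
    using sum_squares_bound[of "cmod a" "cmod b"] by (simp add: power2_sum)
  finally show ?thesis .
qed

lemma da_seq_add:
  assumes "x \<in> da_seq" "y \<in> da_seq"
  shows "(\<lambda>i. x i + y i) \<in> da_seq"
  by (rule da_seq_bound[OF _ assms, of 2]) (use power2_cmod_add_le in auto)

lemma da_seq_scale:
  assumes "x \<in> da_seq"
  shows "(\<lambda>i. a * x i) \<in> da_seq"
  by (rule da_seq_bound[OF _ assms assms, of "(cmod a)\<^sup>2"])
     (simp_all add: norm_mult power_mult_distrib algebra_simps)

lemma da_seq_finite:
  assumes "finite {i. x i \<noteq> 0}"
  shows "x \<in> da_seq"
  unfolding da_seq_def mem_Collect_eq
  by (rule finite_nonzero_values_imp_summable_on) (use assms in \<open>auto elim: rev_finite_subset\<close>)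

lemma summable_binomial_square:
  fixes a b :: real
  assumes "a \<ge> 0" "b \<ge> 0" "a + b < 1"
  shows "(\<lambda>i. real ((fst i + snd i) choose (fst i)) * (a ^ fst i * b ^ snd i)) summable_on UNIV"
    (is "?f summable_on _")
proof (rule nonneg_bdd_above_summable_on)
  show nn: "0 \<le> ?f i" for i
    using assms by simp
  show "bdd_above (sum ?f ` {F. F \<subseteq> UNIV \<and> finite F})"
  proof (rule bdd_aboveI2)
    fix F :: "(nat \<times> nat) set" assume "F \<in> {F. F \<subseteq> UNIV \<and> finite F}"
    then have fin: "finite F" by simp
    define N where "N = Suc (Max (insert 0 ((\<lambda>i. fst i + snd i) ` F)))"
    have F: "F \<subseteq> {(i, j). i + j < N}"
      using fin by (auto simp: N_def less_Suc_eq_le intro!: Max_ge intro: rev_image_eqI)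
    have "finite {(i::nat, j::nat). i + j < N}"
      by (rule finite_subset[of _ "{..<N} \<times> {..<N}"]) auto
    then have "sum ?f F \<le> sum ?f {(i, j). i + j < N}"
      by (rule sum_mono2[OF _ F]) (use nn in auto)
    also have "\<dots> = (\<Sum>(i, j)\<in>{(i, j). i + j < N}. real ((i + j) choose i) * (a ^ i * b ^ j))"
      by (intro sum.cong) auto
    also have "\<dots> = (\<Sum>k<N. \<Sum>i\<le>k. real ((i + (k - i)) choose i) * (a ^ i * b ^ (k - i)))"
      by (rule sum.triangle_reindex)
    also have "\<dots> = (\<Sum>k<N. (a + b) ^ k)"
      by (intro sum.cong refl) (simp add: binomial_ring mult.assoc)
    also have "\<dots> \<le> (\<Sum>k. (a + b) ^ k)"
      using assms by (intro sum_le_suminf summable_geometric) auto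
    finally show "sum ?f F \<le> (\<Sum>k. (a + b) ^ k)" .
  qed
qed

lemma ball_unit_iff: "z \<in> ball (0 :: complex \<times> complex) 1 \<longleftrightarrow> (cmod (fst z))\<^sup>2 + (cmod (snd z))\<^sup>2 < 1"
  by (simp add: dist_norm norm_prod_def)

lemma da_fun_abs_summable:
  assumes "x \<in> da_seq" "z \<in> ball 0 1"
  shows "(\<lambda>i. norm (x i * monomial i z)) summable_on UNIV"
proof (rule summable_on_comparison_test)
  let ?a = "(cmod (fst z))\<^sup>2" and ?b = "(cmod (snd z))\<^sup>2"
  let ?B = "\<lambda>i. real ((fst i + snd i) choose (fst i))"
  show "(\<lambda>i. da_weight i * (cmod (x i))\<^sup>2 + ?B i * (?a ^ fst i * ?b ^ snd i)) summable_on UNIV"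
    using assms(1) ball_unit_iff[THEN iffD1, OF assms(2)]
    by (intro summable_on_add summable_binomial_square) (auto simp: da_seq_def)
  show "norm (x i * monomial i z) \<le> da_weight i * (cmod (x i))\<^sup>2 + ?B i * (?a ^ fst i * ?b ^ snd i)"
    for i
  proof -
    define B where "B = ?B i"
    have B: "B > 0" by (simp add: B_def)
    define u where "u = cmod (x i) / sqrt B"
    define v where "v = cmod (monomial i z) * sqrt B"
    have "norm (x i * monomial i z) = u * v"
      using B by (simp add: u_def v_def norm_mult)
    also have "\<dots> \<le> u\<^sup>2 + v\<^sup>2"
    proof -
      have "0 \<le> u * v" using B by (simp add: u_def v_def)
      then show ?thesis using sum_squares_bound[of u v] by linarith
    qed
    also have "u\<^sup>2 = da_weight i * (cmod (x i))\<^sup>2"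
      using B by (simp add: u_def power_divide da_weight_def B_def)
    also have "v\<^sup>2 = B * (?a ^ fst i * ?b ^ snd i)"
      using B by (simp add: v_def power_mult_distrib monomial_def norm_mult norm_power
          power_mult[symmetric] mult.commute)
    finally show ?thesis by (simp add: B_def)
  qed
qed auto

lemma da_fun_summable:
  assumes "x \<in> da_seq" "z \<in> ball 0 1"
  shows "(\<lambda>i. x i * monomial i z) summable_on UNIV"
  using da_fun_abs_summable[OF assms] by (rule abs_summable_summable)

lemma da_fun_add:
  assumes "x \<in> da_seq" "y \<in> da_seq"
  shows "da_fun (\<lambda>i. x i + y i) = (\<lambda>z. da_fun x z + da_fun y z)"
proof
  fix z
  show "da_fun (\<lambda>i. x i + y i) z = da_fun x z + da_fun y z"
    using infsum_add[OF da_fun_summable[OF assms(1)] da_fun_summable[OF assms(2)], of z]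
    by (cases "z \<in> ball 0 1") (simp_all only: da_fun_def if_True if_False ring_distribs add_0_left)
qed

lemma da_fun_scale: "da_fun (\<lambda>i. a * x i) = (\<lambda>z. a * da_fun x z)"
proof
  fix z
  show "da_fun (\<lambda>i. a * x i) z = a * da_fun x z"
    using infsum_cmult_right'[of a "\<lambda>i. x i * monomial i z" UNIV]
    by (simp add: da_fun_def mult.assoc)
qed

lemma da_fun_0: "da_fun (\<lambda>_. 0) = (\<lambda>_. 0)"
  by (auto simp: da_fun_def)

lemma power_series_zero:
  fixes a :: "nat \<Rightarrow> complex"
  assumes "\<And>u. cmod u < 1/2 \<Longrightarrow> (\<lambda>m. a m * u ^ m) sums 0"
  shows "a m = 0"
proof -
  have r: "fps_conv_radius (Abs_fps a) \<ge> ereal (1/2)"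
    unfolding fps_conv_radius_def
  proof (rule conv_radius_geI_ex')
    fix \<rho> :: real assume "0 < \<rho>" "ereal \<rho> < ereal (1/2)"
    then show "summable (\<lambda>n. fps_nth (Abs_fps a) n * of_real \<rho> ^ n)"
      using sums_summable[OF assms[of "of_real \<rho>"]] by simp
  qed
  have "Abs_fps a = 0"
  proof (rule eval_fps_eqD)
    show "0 < fps_conv_radius (Abs_fps a)"
      by (rule less_le_trans[OF _ r]) (simp add: zero_ereal_def)
    have "eventually (\<lambda>u. u \<in> ball 0 (1/2)) (nhds (0::complex))"
      by (rule eventually_nhds_in_open) auto
    then show "\<forall>\<^sub>F z in nhds 0. eval_fps (Abs_fps a) z = eval_fps 0 z"
      by eventually_elim (use assms in \<open>auto simp: eval_fps_def dist_norm sums_iff\<close>)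
  qed simp
  then show ?thesis
    by (metis fps_nth_Abs_fps fps_zero_nth)
qed

lemma da_fun_eq_0:
  assumes x: "x \<in> da_seq" and 0: "da_fun x = (\<lambda>_. 0)"
  shows "x = (\<lambda>_. 0)"
proof -
  have mem: "(u, w) \<in> ball 0 1" if "cmod u < 1/2" "cmod w < 1/2" for u w :: complex
    using power_strict_mono[OF that(1), of 2] power_strict_mono[OF that(2), of 2]
    unfolding ball_unit_iff by (simp add: power2_eq_square)
  have sm: "(\<lambda>(m, n). x (m, n) * (u ^ m * w ^ n)) summable_on (UNIV \<times> UNIV)"
    if "cmod u < 1/2" "cmod w < 1/2" for u w
    using da_fun_summable[OF x mem[OF that]]
    by (simp add: monomial_def case_prod_unfold)
  have A: "(\<Sum>\<^sub>\<infinity>n. x (m, n) * w ^ n) = 0" if w: "cmod w < 1/2" for m w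
  proof (rule power_series_zero)
    fix u :: complex assume u: "cmod u < 1/2"
    have row: "(\<Sum>\<^sub>\<infinity>n. x (m, n) * (u ^ m * w ^ n)) = (\<Sum>\<^sub>\<infinity>n. x (m, n) * w ^ n) * u ^ m" for m
      using infsum_cmult_left'[of "\<lambda>n. x (m, n) * w ^ n" "u ^ m" UNIV] by (simp add: mult_ac)
    have "(\<Sum>\<^sub>\<infinity>i. x i * monomial i (u, w)) = 0"
      using fun_cong[OF 0, of "(u, w)"] mem[OF u w] by (simp add: da_fun_def)
    then have "(\<Sum>\<^sub>\<infinity>m. (\<Sum>\<^sub>\<infinity>n. x (m, n) * w ^ n) * u ^ m) = 0"
      using infsum_Sigma'_banach[OF sm[OF u w]]
      by (simp add: row monomial_def case_prod_unfold)
    moreover have "(\<lambda>m. (\<Sum>\<^sub>\<infinity>n. x (m, n) * w ^ n) * u ^ m) summable_on UNIV"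
      using summable_on_Sigma_banach[OF sm[OF u w]] by (simp add: row)
    ultimately have "((\<lambda>m. (\<Sum>\<^sub>\<infinity>n. x (m, n) * w ^ n) * u ^ m) has_sum 0) UNIV"
      by (simp add: has_sum_iff)
    then show "(\<lambda>m. (\<Sum>\<^sub>\<infinity>n. x (m, n) * w ^ n) * u ^ m) sums 0"
      by (rule has_sum_imp_sums)
  qed
  have "x (m, n) = 0" for m n
  proof (rule power_series_zero[where a = "\<lambda>n. x (m, n)"])
    fix w :: complex assume w: "cmod w < 1/2"
    define u :: complex where "u = 1/4"
    have u: "cmod u < 1/2" "u \<noteq> 0" by (simp_all add: u_def)
    have "(\<lambda>n. x (m, n) * (u ^ m * w ^ n)) summable_on UNIV"
      using summable_on_SigmaD1[OF sm[OF u(1) w], of m] by simp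
    then have "(\<lambda>n. inverse (u ^ m) * (x (m, n) * (u ^ m * w ^ n))) summable_on UNIV"
      by (rule summable_on_cmult_right)
    moreover have "inverse (u ^ m) * (x (m, n) * (u ^ m * w ^ n)) = x (m, n) * w ^ n" for n
      using u(2) by (simp add: field_simps)
    ultimately have "(\<lambda>n. x (m, n) * w ^ n) summable_on UNIV" by simp
    then show "(\<lambda>n. x (m, n) * w ^ n) sums 0"
      using A[OF w, of m] by (intro has_sum_imp_sums) (simp add: has_sum_iff)
  qed
  then show ?thesis by auto
qed

lemma inj_on_da_fun: "inj_on da_fun da_seq"
proof (rule inj_onI)
  fix x y assume x: "x \<in> da_seq" and y: "y \<in> da_seq" and eq: "da_fun x = da_fun y"
  have m: "(\<lambda>i. - 1 * y i) \<in> da_seq"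
    by (rule da_seq_scale[OF y])
  have "da_fun (\<lambda>i. x i + - 1 * y i) = (\<lambda>_. 0)"
    unfolding da_fun_add[OF x m] da_fun_scale by (simp add: eq)
  then have "(\<lambda>i. x i + - 1 * y i) = (\<lambda>_. 0)"
    by (rule da_fun_eq_0[OF da_seq_add[OF x m]])
  then have "x i + - 1 * y i = 0" for i
    by (rule fun_cong)
  then show "x = y"
    by (intro ext) (simp add: eq_neg_iff_add_eq_0)
qed

typedef drury_arveson = "da_fun ` da_seq"
  morphisms da_eval Abs_da
  using da_seq_0 by blast

setup_lifting type_definition_drury_arveson

text \<open>The power series coefficients; see \<open>inj_on_da_fun\<close> for their uniqueness.\<close>

definition da_coeff :: "drury_arveson \<Rightarrow> nat \<times> nat \<Rightarrow> complex" where
  "da_coeff f = inv_into da_seq da_fun (da_eval f)"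

lemma da_coeff_mem: "da_coeff f \<in> da_seq"
  and da_fun_coeff: "da_fun (da_coeff f) = da_eval f"
  unfolding da_coeff_def by (rule inv_into_into[OF da_eval], rule f_inv_into_f[OF da_eval])

lemma da_coeff_eqI:
  assumes "x \<in> da_seq" "da_eval f = da_fun x"
  shows "da_coeff f = x"
  unfolding da_coeff_def assms(2) by (rule inv_into_f_f[OF inj_on_da_fun assms(1)])

lemma da_eqI:
  assumes "\<And>i. da_coeff f i = da_coeff g i"
  shows "f = g"
  by (metis assms da_fun_coeff da_eval_inject ext)

instantiation drury_arveson :: real_vector
begin

lift_definition zero_drury_arveson :: drury_arveson is "\<lambda>_. 0"
  by (rule image_eqI[where f = da_fun, OF da_fun_0[symmetric] da_seq_0])

lift_definition plus_drury_arveson :: "drury_arveson \<Rightarrow> drury_arveson \<Rightarrow> drury_arveson"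
  is "\<lambda>f g z. f z + g z"
  by (auto intro!: image_eqI[where f = da_fun, OF da_fun_add[symmetric]] da_seq_add)

lift_definition uminus_drury_arveson :: "drury_arveson \<Rightarrow> drury_arveson" is "\<lambda>f z. - f z"
proof -
  fix f assume "f \<in> da_fun ` da_seq"
  then obtain x where "x \<in> da_seq" "f = da_fun x" by blast
  then show "(\<lambda>z. - f z) \<in> da_fun ` da_seq"
    using da_seq_scale[of x "-1"] da_fun_scale[of "-1" x]
    by (intro image_eqI[of _ _ "\<lambda>i. - x i"]) auto
qed

definition minus_drury_arveson :: "drury_arveson \<Rightarrow> drury_arveson \<Rightarrow> drury_arveson" where
  "minus_drury_arveson f g = f + (- g)"

lift_definition scaleR_drury_arveson :: "real \<Rightarrow> drury_arveson \<Rightarrow> drury_arveson"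
  is "\<lambda>r f z. of_real r * f z"
  by (auto intro!: image_eqI[where f = da_fun, OF da_fun_scale[symmetric]] da_seq_scale)

instance
proof
  fix f g h :: drury_arveson and r s :: real
  show "f + g + h = f + (g + h)" by transfer (simp add: add.assoc)
  show "f + g = g + f" by transfer (simp add: add.commute)
  show "0 + f = f" by transfer simp
  show "- f + f = 0" by transfer simp
  show "f - g = f + - g" by (rule minus_drury_arveson_def)
  show "r *\<^sub>R (f + g) = r *\<^sub>R f + r *\<^sub>R g" by transfer (simp add: ring_distribs)
  show "(r + s) *\<^sub>R f = r *\<^sub>R f + s *\<^sub>R f" by transfer (simp add: ring_distribs)
  show "r *\<^sub>R s *\<^sub>R f = (r * s) *\<^sub>R f" by transfer (simp add: mult.assoc)
  show "1 *\<^sub>R f = f" by transfer simp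
qed

end

lemma da_coeff_add: "da_coeff (f + g) i = da_coeff f i + da_coeff g i"
proof -
  have "da_coeff (f + g) = (\<lambda>i. da_coeff f i + da_coeff g i)"
    by (rule da_coeff_eqI[OF da_seq_add[OF da_coeff_mem da_coeff_mem]])
       (simp only: da_fun_add[OF da_coeff_mem da_coeff_mem] da_fun_coeff plus_drury_arveson.rep_eq)
  then show ?thesis by simp
qed

lemma da_coeff_scaleR: "da_coeff (r *\<^sub>R f) i = of_real r * da_coeff f i"
proof -
  have "da_coeff (r *\<^sub>R f) = (\<lambda>i. of_real r * da_coeff f i)"
    by (rule da_coeff_eqI[OF da_seq_scale[OF da_coeff_mem]])
       (simp only: da_fun_scale da_fun_coeff scaleR_drury_arveson.rep_eq)
  then show ?thesis by simp
qed

lemma da_coeff_0: "da_coeff 0 i = 0"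
proof -
  have "da_coeff 0 = (\<lambda>_. 0)"
    by (rule da_coeff_eqI[OF da_seq_0]) (simp only: da_fun_0 zero_drury_arveson.rep_eq)
  then show ?thesis by simp
qed

lemma da_coeff_diff: "da_coeff (f - g) i = da_coeff f i - da_coeff g i"
  using da_coeff_add[of f "-1 *\<^sub>R g" i] da_coeff_scaleR[of "-1" g i] by simp

definition da_cinner :: "drury_arveson \<Rightarrow> drury_arveson \<Rightarrow> complex" where
  "da_cinner f g = (\<Sum>\<^sub>\<infinity>i. of_real (da_weight i) * (da_coeff f i * cnj (da_coeff g i)))"

lemma da_cinner_summable:
  "(\<lambda>i. of_real (da_weight i) * (da_coeff f i * cnj (da_coeff g i))) summable_on UNIV"
proof (rule abs_summable_summable, rule summable_on_comparison_test)
  show "(\<lambda>i. da_weight i * (cmod (da_coeff f i))\<^sup>2 + da_weight i * (cmod (da_coeff g i))\<^sup>2)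
        summable_on UNIV"
    using da_coeff_mem[of f] da_coeff_mem[of g] by (intro summable_on_add) (auto simp: da_seq_def)
  show "norm (of_real (da_weight i) * (da_coeff f i * cnj (da_coeff g i)))
        \<le> da_weight i * (cmod (da_coeff f i))\<^sup>2 + da_weight i * (cmod (da_coeff g i))\<^sup>2" for i
  proof -
    have "cmod (da_coeff f i) * cmod (da_coeff g i) \<le> (cmod (da_coeff f i))\<^sup>2 + (cmod (da_coeff g i))\<^sup>2"
    proof -
      have "0 \<le> cmod (da_coeff f i) * cmod (da_coeff g i)" by simp
      then show ?thesis
        using sum_squares_bound[of "cmod (da_coeff f i)" "cmod (da_coeff g i)"] by linarith
    qed
    from mult_left_mono[OF this, of "da_weight i"] da_weight_pos[of i] show ?thesis
      by (simp add: norm_mult algebra_simps)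
  qed
qed auto

lemma da_cinner_commute: "da_cinner f g = cnj (da_cinner g f)"
  unfolding da_cinner_def infsum_cnj[symmetric] by (simp add: mult_ac)

lemma da_cinner_add_left: "da_cinner (f + g) h = da_cinner f h + da_cinner g h"
  unfolding da_cinner_def infsum_add[OF da_cinner_summable da_cinner_summable, symmetric]
  by (simp add: da_coeff_add ring_distribs)

lemma da_cinner_self: "da_cinner f f = of_real (\<Sum>\<^sub>\<infinity>i. da_weight i * (cmod (da_coeff f i))\<^sup>2)"
proof -
  have "of_real (da_weight i) * (da_coeff f i * cnj (da_coeff f i))
      = complex_of_real (da_weight i * (cmod (da_coeff f i))\<^sup>2)" for i
    by (simp add: complex_norm_square[symmetric])
  moreover have "(\<lambda>i. da_weight i * (cmod (da_coeff f i))\<^sup>2) summable_on UNIV"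
    using da_coeff_mem[of f] by (simp add: da_seq_def)
  then have "((\<lambda>i. complex_of_real (da_weight i * (cmod (da_coeff f i))\<^sup>2))
      has_sum of_real (\<Sum>\<^sub>\<infinity>i. da_weight i * (cmod (da_coeff f i))\<^sup>2)) UNIV"
    by (intro has_sum_of_real has_sum_infsum)
  ultimately show ?thesis
    unfolding da_cinner_def by (simp only: infsumI)
qed

instantiation drury_arveson :: real_inner
begin

definition inner_drury_arveson :: "drury_arveson \<Rightarrow> drury_arveson \<Rightarrow> real" where
  "inner_drury_arveson f g = Re (da_cinner f g)"

definition norm_drury_arveson :: "drury_arveson \<Rightarrow> real" where
  "norm_drury_arveson f = sqrt (inner f f)"

definition sgn_drury_arveson :: "drury_arveson \<Rightarrow> drury_arveson" where
  "sgn_drury_arveson f = f /\<^sub>R norm f"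

definition dist_drury_arveson :: "drury_arveson \<Rightarrow> drury_arveson \<Rightarrow> real" where
  "dist_drury_arveson f g = norm (f - g)"

definition uniformity_drury_arveson :: "(drury_arveson \<times> drury_arveson) filter" where
  "uniformity_drury_arveson = (INF e\<in>{0<..}. principal {(f, g). dist f g < e})"

definition open_drury_arveson :: "drury_arveson set \<Rightarrow> bool" where
  "open_drury_arveson U \<longleftrightarrow> (\<forall>f\<in>U. \<forall>\<^sub>F (f', g) in uniformity. f' = f \<longrightarrow> g \<in> U)"

instance
proof
  fix f g h :: drury_arveson and r :: real
  show "inner f g = inner g f"
    unfolding inner_drury_arveson_def by (subst da_cinner_commute) simp
  show "inner (f + g) h = inner f h + inner g h"
    by (simp add: inner_drury_arveson_def da_cinner_add_left)
  have "da_cinner (r *\<^sub>R f) g = of_real r * da_cinner f g"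
    unfolding da_cinner_def infsum_cmult_right'[symmetric]
    by (simp add: da_coeff_scaleR mult_ac)
  then show "inner (r *\<^sub>R f) g = r * inner f g"
    by (simp add: inner_drury_arveson_def)
  show "0 \<le> inner f f"
    unfolding inner_drury_arveson_def da_cinner_self
    by (simp add: infsum_nonneg da_weight_pos less_imp_le)
  show "inner f f = 0 \<longleftrightarrow> f = 0"
  proof
    assume "inner f f = 0"
    then have 0: "(\<Sum>\<^sub>\<infinity>i. da_weight i * (cmod (da_coeff f i))\<^sup>2) = 0"
      by (simp add: inner_drury_arveson_def da_cinner_self)
    have "da_weight i * (cmod (da_coeff f i))\<^sup>2 = 0" for i
      by (rule nonneg_infsum_le_0D[of "\<lambda>i. da_weight i * (cmod (da_coeff f i))\<^sup>2" UNIV])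
         (use 0 da_coeff_mem[of f] da_weight_pos in \<open>auto simp: da_seq_def less_imp_le\<close>)
    then show "f = 0"
      by (intro da_eqI) (use da_weight_pos in \<open>auto simp: da_coeff_0 less_le\<close>)
  next
    assume "f = 0"
    then show "inner f f = 0"
      by (simp add: inner_drury_arveson_def da_cinner_self da_coeff_0)
  qed
qed (simp_all add: norm_drury_arveson_def sgn_drury_arveson_def dist_drury_arveson_def
    uniformity_drury_arveson_def open_drury_arveson_def)

end

lemma da_norm_square: "(norm f)\<^sup>2 = (\<Sum>\<^sub>\<infinity>i. da_weight i * (cmod (da_coeff f i))\<^sup>2)"
  unfolding norm_eq_sqrt_inner inner_drury_arveson_def da_cinner_self
  by (simp add: infsum_nonneg da_weight_pos less_imp_le)

lemma da_finite_sum_le: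
  assumes "finite I"
  shows "(\<Sum>i\<in>I. da_weight i * (cmod (da_coeff f i))\<^sup>2) \<le> (norm f)\<^sup>2"
  unfolding da_norm_square
  by (rule finite_sum_le_infsum)
     (use assms da_coeff_mem[of f] da_weight_pos in \<open>auto simp: da_seq_def less_imp_le\<close>)

lemma da_coeff_le: "da_weight i * (cmod (da_coeff f i))\<^sup>2 \<le> (norm f)\<^sup>2"
  using da_finite_sum_le[of "{i}" f] by simp

instance drury_arveson :: complete_space
proof
  fix X :: "nat \<Rightarrow> drury_arveson"
  assume X: "Cauchy X"
  have "Cauchy (\<lambda>n. da_coeff (X n) i)" for i
  proof (rule metric_CauchyI)
    fix e :: real assume e: "e > 0"
    with da_weight_pos[of i] have "e * sqrt (da_weight i) > 0" by simp
    from metric_CauchyD[OF X this] obtain M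
      where M: "\<And>m n. m \<ge> M \<Longrightarrow> n \<ge> M \<Longrightarrow> dist (X m) (X n) < e * sqrt (da_weight i)" by blast
    have "dist (da_coeff (X m) i) (da_coeff (X n) i) < e" if "m \<ge> M" "n \<ge> M" for m n
    proof -
      have "(sqrt (da_weight i) * cmod (da_coeff (X m - X n) i))\<^sup>2 \<le> (norm (X m - X n))\<^sup>2"
        using da_coeff_le[of i "X m - X n"] da_weight_pos[of i] by (simp add: power_mult_distrib)
      then have "sqrt (da_weight i) * cmod (da_coeff (X m - X n) i) \<le> norm (X m - X n)"
        by (rule power2_le_imp_le) simp
      also have "\<dots> < e * sqrt (da_weight i)"
        using M[OF that] by (simp add: dist_norm)
      finally show ?thesis
        using da_weight_pos[of i] by (simp add: dist_norm da_coeff_diff)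
    qed
    then show "\<exists>M. \<forall>m\<ge>M. \<forall>n\<ge>M. dist (da_coeff (X m) i) (da_coeff (X n) i) < e" by blast
  qed
  then have "\<exists>c. (\<lambda>n. da_coeff (X n) i) \<longlonglongrightarrow> c" for i
    by (simp add: Cauchy_convergent_iff convergent_def)
  then obtain c where c: "\<And>i. (\<lambda>n. da_coeff (X n) i) \<longlonglongrightarrow> c i" by metis
  have bound: "(\<Sum>i\<in>I. da_weight i * (cmod (da_coeff (X m) i - c i))\<^sup>2) \<le> e\<^sup>2"
    if I: "finite I" and e: "e > 0" and M: "\<And>m n. m \<ge> M \<Longrightarrow> n \<ge> M \<Longrightarrow> dist (X m) (X n) < e"
      and m: "m \<ge> M" for I e M m
  proof (rule LIMSEQ_le_const2)
    show "(\<lambda>n. \<Sum>i\<in>I. da_weight i * (cmod (da_coeff (X m) i - da_coeff (X n) i))\<^sup>2)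
          \<longlonglongrightarrow> (\<Sum>i\<in>I. da_weight i * (cmod (da_coeff (X m) i - c i))\<^sup>2)"
      by (intro tendsto_intros c)
    have "(\<Sum>i\<in>I. da_weight i * (cmod (da_coeff (X m) i - da_coeff (X n) i))\<^sup>2) \<le> e\<^sup>2" if "n \<ge> M" for n
    proof -
      have "(\<Sum>i\<in>I. da_weight i * (cmod (da_coeff (X m - X n) i))\<^sup>2) \<le> (norm (X m - X n))\<^sup>2"
        by (rule da_finite_sum_le[OF I])
      also have "\<dots> \<le> e\<^sup>2"
        using M[OF m that] by (intro power_mono) (simp_all add: dist_norm)
      finally show ?thesis by (simp add: da_coeff_diff)
    qed
    then show "\<exists>N. \<forall>n\<ge>N. (\<Sum>i\<in>I. da_weight i * (cmod (da_coeff (X m) i - da_coeff (X n) i))\<^sup>2) \<le> e\<^sup>2"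
      by blast
  qed
  have seq: "(\<lambda>i. da_coeff (X m) i - c i) \<in> da_seq"
    if e: "e > 0" and M: "\<And>m n. m \<ge> M \<Longrightarrow> n \<ge> M \<Longrightarrow> dist (X m) (X n) < e" and m: "m \<ge> M" for e M m
    unfolding da_seq_def mem_Collect_eq
  proof (rule nonneg_bdd_above_summable_on)
    show "bdd_above (sum (\<lambda>i. da_weight i * (cmod (da_coeff (X m) i - c i))\<^sup>2)
            ` {F. F \<subseteq> UNIV \<and> finite F})"
      by (rule bdd_aboveI2[of _ _ "e\<^sup>2"]) (use bound[OF _ e M m] in auto)
  qed (use da_weight_pos in \<open>auto simp: less_imp_le\<close>)
  have c_mem: "c \<in> da_seq"
  proof -
    from metric_CauchyD[OF X, of 1] obtain M
      where M: "\<And>m n. m \<ge> M \<Longrightarrow> n \<ge> M \<Longrightarrow> dist (X m) (X n) < 1" by auto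
    have "(\<lambda>i. da_coeff (X M) i + - 1 * (da_coeff (X M) i - c i)) \<in> da_seq"
      by (intro da_seq_add da_coeff_mem da_seq_scale seq[OF zero_less_one M]) auto
    then show ?thesis by simp
  qed
  define L where "L = Abs_da (da_fun c)"
  have L: "da_coeff L = c"
    by (rule da_coeff_eqI[OF c_mem]) (use c_mem in \<open>simp add: L_def Abs_da_inverse\<close>)
  have "X \<longlonglongrightarrow> L"
  proof (rule metric_LIMSEQ_I)
    fix r :: real assume r: "r > 0"
    define e where "e = r / 2"
    have e: "e > 0" "e < r" using r by (simp_all add: e_def)
    from metric_CauchyD[OF X e(1)] obtain M
      where M: "\<And>m n. m \<ge> M \<Longrightarrow> n \<ge> M \<Longrightarrow> dist (X m) (X n) < e" by blast
    have "dist (X m) L < r" if m: "m \<ge> M" for m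
    proof -
      have "(norm (X m - L))\<^sup>2 \<le> e\<^sup>2"
        unfolding da_norm_square da_coeff_diff L
        by (rule infsum_le_finite_sums) (use seq[OF e(1) M m] bound[OF _ e(1) M m] in \<open>auto simp: da_seq_def\<close>)
      then have "norm (X m - L) \<le> e"
        by (rule power2_le_imp_le) (use e in simp)
      then show ?thesis using e by (simp add: dist_norm)
    qed
    then show "\<exists>M. \<forall>m\<ge>M. dist (X m) L < r" by blast
  qed
  then show "convergent X" by (auto simp: convergent_def)
qed

instantiation drury_arveson :: complex_hilbert
begin

lift_definition scaleC_drury_arveson :: "complex \<Rightarrow> drury_arveson \<Rightarrow> drury_arveson"
  is "\<lambda>a f z. a * f z"
  by (auto intro!: image_eqI[where f = da_fun, OF da_fun_scale[symmetric]] da_seq_scale)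

definition cinner_drury_arveson :: "drury_arveson \<Rightarrow> drury_arveson \<Rightarrow> complex" where
  "cinner_drury_arveson = da_cinner"

lemma da_coeff_scaleC: "da_coeff (a *\<^sub>C f) i = a * da_coeff f i"
proof -
  have "da_coeff (a *\<^sub>C f) = (\<lambda>i. a * da_coeff f i)"
    by (rule da_coeff_eqI[OF da_seq_scale[OF da_coeff_mem]])
       (simp only: da_fun_scale da_fun_coeff scaleC_drury_arveson.rep_eq)
  then show ?thesis by simp
qed

instance
proof
  fix f g h :: drury_arveson and a b :: complex and r :: real
  show "a *\<^sub>C (f + g) = a *\<^sub>C f + a *\<^sub>C g"
    by (rule da_eqI) (simp add: da_coeff_scaleC da_coeff_add algebra_simps)
  show "(a + b) *\<^sub>C f = a *\<^sub>C f + b *\<^sub>C f"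
    by (rule da_eqI) (simp add: da_coeff_scaleC da_coeff_add algebra_simps)
  show "a *\<^sub>C b *\<^sub>C f = (a * b) *\<^sub>C f"
    by (rule da_eqI) (simp add: da_coeff_scaleC)
  show "of_real r *\<^sub>C f = r *\<^sub>R f"
    by (rule da_eqI) (simp add: da_coeff_scaleC da_coeff_scaleR)
  show "cinner f g = cnj (cinner g f)"
    unfolding cinner_drury_arveson_def by (rule da_cinner_commute)
  show "cinner (f + g) h = cinner f h + cinner g h"
    unfolding cinner_drury_arveson_def by (rule da_cinner_add_left)
  show "cinner (a *\<^sub>C f) g = a * cinner f g"
    unfolding cinner_drury_arveson_def da_cinner_def infsum_cmult_right'[symmetric]
    by (simp add: da_coeff_scaleC mult_ac)
  show "Re (cinner f g) = inner f g"
    by (simp add: cinner_drury_arveson_def inner_drury_arveson_def)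
qed

end


section \<open>Polynomials in the Drury-Arveson space\<close>

text \<open>The ring \<open>\<complex>[z\<^sub>1, z\<^sub>2]\<close> is \<^typ>\<open>complex poly poly\<close>, with outer variable \<open>z\<^sub>1\<close> and coefficients
  in \<open>\<complex>[z\<^sub>2]\<close>.\<close>

definition eval2 :: "complex poly poly \<Rightarrow> complex \<times> complex \<Rightarrow> complex" where
  "eval2 q z = poly (poly q [:fst z:]) (snd z)"

definition da_of_poly :: "complex poly poly \<Rightarrow> drury_arveson" where
  "da_of_poly q = Abs_da (\<lambda>z. if z \<in> ball 0 1 then eval2 q z else 0)"

definition principal_ideal :: "'a::comm_ring_1 \<Rightarrow> 'a set" where
  "principal_ideal g = {q * g | q. True}"

definition ideal_I :: "nat \<Rightarrow> real \<Rightarrow> real \<Rightarrow> complex poly poly set" where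
  "ideal_I k \<epsilon> t = principal_ideal (monom 1 k - [:[:of_real \<epsilon> * exp (\<i> * of_real t):]:])"

definition ideal_perp :: "nat \<Rightarrow> real \<Rightarrow> real \<Rightarrow> drury_arveson set" where
  "ideal_perp k \<epsilon> t = orthogonal_complement (da_of_poly ` ideal_I k \<epsilon> t)"

lemma eval2_altdef:
  "eval2 q z = (\<Sum>m\<le>degree q. \<Sum>n\<le>degree (coeff q m). coeff (coeff q m) n * monomial (m, n) z)"
proof -
  have "eval2 q z = (\<Sum>m\<le>degree q. poly (coeff q m) (snd z) * fst z ^ m)"
    unfolding eval2_def by (subst poly_altdef) (simp add: poly_sum)
  also have "\<dots> = (\<Sum>m\<le>degree q. \<Sum>n\<le>degree (coeff q m). coeff (coeff q m) n * monomial (m, n) z)"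
    by (simp add: poly_altdef monomial_def sum_distrib_left sum_distrib_right mult_ac)
  finally show ?thesis .
qed

lemma da_seq_poly: "(\<lambda>i. coeff (coeff q (fst i)) (snd i)) \<in> da_seq"
  and da_fun_poly: "da_fun (\<lambda>i. coeff (coeff q (fst i)) (snd i)) z
    = (if z \<in> ball 0 1 then eval2 q z else 0)"
proof -
  define S where "S = (SIGMA m:{..degree q}. {..degree (coeff q m)})"
  have fin: "finite S" by (auto simp: S_def)
  have out: "coeff (coeff q (fst i)) (snd i) = 0" if "i \<notin> S" for i
    using that by (cases i) (auto simp: S_def coeff_eq_0 not_le)
  show "(\<lambda>i. coeff (coeff q (fst i)) (snd i)) \<in> da_seq"
    by (rule da_seq_finite, rule finite_subset[OF _ fin]) (use out in auto)
  have "(\<Sum>\<^sub>\<infinity>i. coeff (coeff q (fst i)) (snd i) * monomial i z)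
      = (\<Sum>i\<in>S. coeff (coeff q (fst i)) (snd i) * monomial i z)"
    by (rule infsumI, rule has_sum_finite_neutralI[OF fin]) (use out in auto)
  also have "\<dots> = eval2 q z"
    unfolding eval2_altdef S_def by (subst sum.Sigma) (auto simp: case_prod_beta)
  finally show "da_fun (\<lambda>i. coeff (coeff q (fst i)) (snd i)) z
    = (if z \<in> ball 0 1 then eval2 q z else 0)"
    by (simp add: da_fun_def)
qed

lemma da_eval_of_poly: "da_eval (da_of_poly q) z = (if z \<in> ball 0 1 then eval2 q z else 0)"
proof -
  have "(\<lambda>z. if z \<in> ball 0 1 then eval2 q z else 0) \<in> da_fun ` da_seq"
    by (rule image_eqI[OF _ da_seq_poly[of q]]) (simp add: fun_eq_iff da_fun_poly)
  then show ?thesis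
    by (simp add: da_of_poly_def Abs_da_inverse)
qed

lemma da_coeff_of_poly: "da_coeff (da_of_poly q) (m, n) = coeff (coeff q m) n"
proof -
  have "da_coeff (da_of_poly q) = (\<lambda>i. coeff (coeff q (fst i)) (snd i))"
    by (rule da_coeff_eqI[OF da_seq_poly]) (simp only: fun_eq_iff da_eval_of_poly da_fun_poly simp_thms)
  then show ?thesis by simp
qed

lemma cinner_monomials:
  "cinner (da_of_poly (monom (monom 1 n) m)) (da_of_poly (monom (monom 1 n') m'))
   = (if m = m' \<and> n = n' then 1 / of_nat ((m + n) choose m) else 0)"
proof -
  have "((\<lambda>i. of_real (da_weight i) * (da_coeff (da_of_poly (monom (monom 1 n) m)) i
           * cnj (da_coeff (da_of_poly (monom (monom 1 n') m')) i)))
     has_sum (if m = m' \<and> n = n' then 1 / of_nat ((m + n) choose m) else 0)) UNIV"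
    by (rule has_sum_finite_neutralI[of "{(m, n)}"])
       (auto simp: da_coeff_of_poly da_weight_def split: if_splits)
  then show ?thesis
    unfolding cinner_drury_arveson_def da_cinner_def by (rule infsumI)
qed

end

theory Submission
  imports Defs
begin

text \<open>Membership of \<open>\<xi>\<close> in \<open>I(t)\<^sup>\<bottom>\<close> is the recursion
  \<open>\<omega>\<^sub>m\<^sub>+\<^sub>k\<^sub>,\<^sub>n \<xi>\<^sub>m\<^sub>+\<^sub>k\<^sub>,\<^sub>n = \<epsilon> e\<^sup>-\<^sup>i\<^sup>t \<omega>\<^sub>m\<^sub>,\<^sub>n \<xi>\<^sub>m\<^sub>,\<^sub>n\<close> on the coefficients. So the diagonal unitary
  that multiplies the \<open>(m, n)\<close>-th coefficient by \<open>e\<^sup>i\<^sup>t\<close> to the power \<open>m div k\<close> carries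
  \<open>I(t)\<^sup>\<bottom>\<close> onto \<open>I(0)\<^sup>\<bottom>\<close>. It depends on \<open>e\<^sup>i\<^sup>t\<close> only, and strongly continuously,
  which suffices for joint continuity in \<open>(t, \<xi>)\<close>. This single global trivialization,
  over the line as well as over the circle, makes up the whole atlas, and its only transition map
  is the identity.\<close>

section \<open>Smooth maps with constant derivative\<close>

lemma smooth_on_const: "smooth_on S (\<lambda>_. c)"
proof (coinduction arbitrary: c)
  case smooth_on
  show ?case
    \<comment> \<open>The derivative 0 has constant directional derivatives, so the family of all
      constants is closed under the coinduction step.\<close>
    by (rule exI, rule exI[of _ "\<lambda>_ _. 0"]) auto
qed

text \<open>One unfolding of the coinductive rule suffices, because \<open>x \<mapsto> D v\<close>
  is constant. This covers the identity and the translations between circle charts.\<close>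

lemma smooth_on_constant_derivative:
  assumes "\<And>x. x \<in> S \<Longrightarrow> (f has_derivative D) (at x within S)"
  shows "smooth_on S f"
  by (rule smooth_on.intros[of S f "\<lambda>_. D"]) (use assms smooth_on_const in auto)

lemma smooth_on_identity:
  assumes "\<And>x. x \<in> S \<Longrightarrow> f x = x"
  shows "smooth_on S f"
proof (rule smooth_on_constant_derivative)
  fix x assume x: "x \<in> S"
  show "(f has_derivative (\<lambda>v. v)) (at x within S)"
    by (rule has_derivative_transform[OF x assms has_derivative_ident])
qed

section \<open>Globally trivialized bundles\<close>

text \<open>Surjectivity onto \<open>T\<close> turns the left inverse \<open>g\<close> into a
  two-sided one.\<close>

lemma homeomorphic_map_of_sets:
  assumes "continuous_on S f" "continuous_on T g" "f ` S = T" "\<And>x. x \<in> S \<Longrightarrow> g (f x) = x"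
  shows "homeomorphic_map (top_of_set S) (top_of_set T) f"
proof -
  have "homeomorphic_maps (top_of_set S) (top_of_set T) f g"
    unfolding homeomorphic_maps_def continuous_map_subtopology_eu
    using assms by (auto simp: continuous_map_in_subtopology image_subset_iff)
  then show ?thesis
    using homeomorphic_map_maps by blast
qed

text \<open>The set \<open>E\<close> is the preimage of \<open>UNIV \<times> F\<close> under
  \<open>(b, x) \<mapsto> (b, W b x)\<close>, which is a homeomorphism because \<open>V\<close> and
  \<open>W\<close> are jointly continuous. Restricted to \<open>E\<close>, it is a trivialization
  over the whole base.\<close>

lemma smooth_hilbert_bundle_trivialI:
  fixes C :: "('b::topological_space, 'm::real_normed_vector) chart set"
    and V W :: "'b \<Rightarrow> 'h::complex_hilbert \<Rightarrow> 'h"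
  assumes C: "smooth_atlas C" and F: "closed_csubspace F"
    and V: "continuous_on UNIV (\<lambda>e. V (fst e) (snd e))"
    and W: "continuous_on UNIV (\<lambda>e. W (fst e) (snd e))"
    and WV: "\<And>b x. W b (V b x) = x" and VW: "\<And>b x. V b (W b x) = x"
    and lin: "\<And>b a x y. W b (a *\<^sub>C x + y) = a *\<^sub>C W b x + W b y"
    and E: "\<And>b x. (b, x) \<in> E \<longleftrightarrow> W b x \<in> F"
  shows "smooth_hilbert_bundle C (top_of_set E) fst snd"
  unfolding smooth_hilbert_bundle_def
proof (intro conjI exI)
  define \<phi> where "\<phi> = (\<lambda>e. (fst e, W (fst e) (snd e)))"
  define \<psi> where "\<psi> = (\<lambda>e. (fst e, V (fst e) (snd e)))"
  have surj: "\<phi> ` E = UNIV \<times> F"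
  proof safe
    fix b x assume "x \<in> F"
    then show "(b, x) \<in> \<phi> ` E"
      by (intro image_eqI[of _ _ "(b, V b x)"]) (simp_all add: \<phi>_def E WV)
  qed (simp_all add: \<phi>_def E)
  have fib: "fiber (top_of_set E) fst b = {b} \<times> (W b -` F)" for b
    using E by (auto simp: fiber_def)
  have Wb: "continuous_on UNIV (W b)" for b
    using continuous_on_compose2[OF W, of UNIV "\<lambda>x. (b, x)"] by (simp add: continuous_intros)
  show "smooth_atlas C" by (rule C)
  show "continuous_map (top_of_set E) euclidean fst"
    by (simp add: continuous_on_fst)
  show "closed_csubspace F" by (rule F)
  show "hilbert_fibers (top_of_set E) fst snd"
    unfolding hilbert_fibers_def
  proof (intro allI conjI)
    fix b
    have sub: "fiber (top_of_set E) fst b \<subseteq> E" by (auto simp: fiber_def)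
    have im: "snd ` fiber (top_of_set E) fst b = W b -` F"
      by (simp add: fib)
    \<comment> \<open>Scaling by the complex number 1 is the identity by
      \<open>scaleC_of_real\<close>, so \<open>lin\<close> at zero vectors reads
      \<open>W b 0 = W b 0 + W b 0\<close>.\<close>
    have W0: "W b 0 = 0"
      using lin[of b 1 0 0] scaleC_of_real[of 1, where 'a = 'h] by simp
    have Wadd: "W b (x + y) = W b x + W b y" for x y
      using lin[of b 1 x y] scaleC_of_real[of 1, where 'a = 'h] by simp
    have Wscale: "W b (a *\<^sub>C x) = a *\<^sub>C W b x" for a x
      using lin[of b a x 0] by (simp add: W0)
    show "closed_csubspace (snd ` fiber (top_of_set E) fst b)"
      using F closed_vimage[OF _ Wb, of F] unfolding im closed_csubspace_def
      by (auto simp: W0 Wadd Wscale)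
    have "homeomorphic_map (top_of_set ({b} \<times> (W b -` F))) (top_of_set (W b -` F)) snd"
      by (rule homeomorphic_map_of_sets[where g = "Pair b"]) (auto intro!: continuous_intros)
    then show "homeomorphic_map (subtopology (top_of_set E) (fiber (top_of_set E) fst b))
        (top_of_set (snd ` fiber (top_of_set E) fst b)) snd"
      unfolding im using sub by (simp add: subtopology_subtopology inf_absorb2 fib)
  qed
  show "smooth_hilbert_bundle_atlas C (top_of_set E) fst snd F {(UNIV, \<phi>)}"
    unfolding smooth_hilbert_bundle_atlas_def
  proof (safe; (simp; fail)?)
    have "homeomorphic_map (top_of_set E) (top_of_set (UNIV \<times> F)) \<phi>"
    proof (rule homeomorphic_map_of_sets[where g = \<psi>, OF _ _ surj])
      show "continuous_on E \<phi>" "continuous_on (UNIV \<times> F) \<psi>"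
        unfolding \<phi>_def \<psi>_def
        by (intro continuous_intros continuous_on_subset[OF V] continuous_on_subset[OF W]; simp)+
    qed (simp add: \<phi>_def \<psi>_def VW)
    then show "local_trivialization (top_of_set E) fst snd F UNIV \<phi>"
      unfolding local_trivialization_def by (auto simp: \<phi>_def fiber_def lin)
  next
    fix X \<kappa> assume "(X, \<kappa>) \<in> C"
    show "smooth_on (\<kappa> ` (UNIV \<inter> UNIV \<inter> X) \<times> F)
      (map_prod \<kappa> id \<circ> transition_map (top_of_set E) fst UNIV \<phi> \<phi> \<circ> map_prod (inv_into X \<kappa>) id)"
    proof (rule smooth_on_identity)
      fix x assume x: "x \<in> \<kappa> ` (UNIV \<inter> UNIV \<inter> X) \<times> F"
      then obtain u y where u: "x = (u, y)" "u \<in> \<kappa> ` X" "y \<in> F" by auto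
      \<comment> \<open>Membership in the image lets \<open>\<phi>\<close> cancel its chosen
        inverse; \<open>\<kappa>\<close> then cancels \<open>inv_into X \<kappa>\<close> at
        \<open>u\<close>.\<close>
      have "(inv_into X \<kappa> u, y) \<in> \<phi> ` E" using u by (simp add: surj)
      then show "(map_prod \<kappa> id \<circ> transition_map (top_of_set E) fst UNIV \<phi> \<phi>
          \<circ> map_prod (inv_into X \<kappa>) id) x = x"
        using u by (simp add: transition_map_def f_inv_into_f)
    qed
  qed
qed

section \<open>Charts of the line and the circle\<close>

lemma smooth_atlas_line_charts: "smooth_atlas line_charts"
proof -
  have "smooth_on UNIV (inv_into UNIV (id :: real \<Rightarrow> real))"
    by (rule smooth_on_identity) (simp add: inv_id)
  then show ?thesis
    by (auto simp: smooth_atlas_def line_charts_def homeomorphic_map_id)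
qed

lemma abs_circle_eq_iff: "abs_circle s = abs_circle t \<longleftrightarrow> (\<exists>n::int. t = s + 2 * pi * of_int n)"
  by (simp add: circle.abs_eq_iff circle_rel_def)

lemma abs_circle_surj: obtains t where "c = abs_circle t"
  using Quotient_circle by (metis Quotient_abs_rep)

text \<open>Universal property of the quotient topology.\<close>

lemma continuous_on_circle:
  assumes "continuous_on UNIV (\<lambda>t. f (abs_circle t))"
  shows "continuous_on UNIV f"
  using assms unfolding continuous_on_open_vimage[OF open_UNIV]
  by (auto simp: open_circle_def vimage_def)

lemma continuous_abs_circle: "continuous_on S abs_circle"
  by (rule continuous_on_subset[of UNIV])
    (auto simp: continuous_on_open_vimage open_circle_def)

text \<open>The saturation of \<open>V\<close> is the union of its translates by multiples of
  \<open>2 * pi\<close>, each of them open.\<close>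

lemma open_abs_circle_image:
  assumes "open V" shows "open (abs_circle ` V)"
proof -
  have "abs_circle -` abs_circle ` V = (\<Union>n::int. (\<lambda>t. t + 2 * pi * of_int n) ` V)"
  proof (intro equalityI subsetI)
    fix s assume "s \<in> abs_circle -` abs_circle ` V"
    then obtain t where t: "t \<in> V" "abs_circle t = abs_circle s" by auto
    then obtain n :: int where "s = t + 2 * pi * of_int n"
      by (auto simp: abs_circle_eq_iff)
    with t show "s \<in> (\<Union>n::int. (\<lambda>t. t + 2 * pi * of_int n) ` V)" by blast
  next
    fix s assume "s \<in> (\<Union>n::int. (\<lambda>t. t + 2 * pi * of_int n) ` V)"
    then obtain t and n :: int where t: "t \<in> V" "s = t + 2 * pi * of_int n" by auto
    then have "abs_circle t = abs_circle s" by (auto simp: abs_circle_eq_iff)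
    with t show "s \<in> abs_circle -` abs_circle ` V" by (metis imageI vimageI2)
  qed
  moreover have "open ((\<lambda>t. t + 2 * pi * of_int n) ` V)" for n :: int
    using open_translation[OF assms, of "2 * pi * of_int n"] by (simp add: add.commute)
  ultimately show ?thesis
    unfolding open_circle_def by (metis (no_types, lifting) open_UN)
qed

text \<open>Two points of an open interval of length \<open>2 * pi\<close> differ by less than
  \<open>2 * pi\<close>, which forces the integer \<open>n\<close> to be 0.\<close>

lemma inj_on_abs_circle: "inj_on abs_circle {a<..<a + 2 * pi}"
proof (rule inj_onI)
  fix s t assume st: "s \<in> {a<..<a + 2 * pi}" "t \<in> {a<..<a + 2 * pi}" "abs_circle s = abs_circle t"
  then obtain n :: int where n: "t = s + 2 * pi * of_int n" by (auto simp: abs_circle_eq_iff)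
  have "\<bar>2 * pi * of_int n\<bar> < 2 * pi * 1" using st n by auto
  then have "\<bar>real_of_int n\<bar> < 1" by (simp add: abs_mult)
  then show "s = t" using n by auto
qed

text \<open>The charts are local inverses of the quotient map, continuous because that map is open.
  Transitions are locally translations by \<open>2 * pi * of_int n\<close>.\<close>

lemma smooth_atlas_circle_charts: "smooth_atlas circle_charts"
proof -
  define J where "J a = {a<..<a + 2 * pi}" for a
  define \<kappa> where "\<kappa> a = inv_into (J a) abs_circle" for a
  have op: "open (J a)" for a by (simp add: J_def)
  have inv [simp]: "\<kappa> a (abs_circle t) = t" if "t \<in> J a" for a t
    using that inj_on_abs_circle[of a] by (simp add: \<kappa>_def J_def)
  have im [simp]: "\<kappa> a ` abs_circle ` J a = J a" for a
    by (force simp: image_image)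
  have inj: "inj_on (\<kappa> a) (abs_circle ` J a)" for a
    by (auto simp: inj_on_def)
  have inv': "inv_into (abs_circle ` J a) (\<kappa> a) t = abs_circle t" if "t \<in> J a" for a t
    by (rule inv_into_f_eq[OF inj]) (use that in auto)
  have homeo: "homeomorphic_map (top_of_set (abs_circle ` J a)) (top_of_set (J a)) (\<kappa> a)" for a
  proof (rule homeomorphic_map_of_sets[where g = abs_circle])
    show "continuous_on (abs_circle ` J a) (\<kappa> a)"
      unfolding continuous_on_open_vimage[OF open_abs_circle_image[OF op]]
    proof safe
      fix B :: "real set" assume "open B"
      have "\<kappa> a -` B \<inter> abs_circle ` J a = abs_circle ` (B \<inter> J a)"
        by auto
      then show "open (\<kappa> a -` B \<inter> abs_circle ` J a)"
        using open_abs_circle_image[OF open_Int[OF \<open>open B\<close> op]] by simp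
    qed
  qed (auto intro: continuous_abs_circle)
  have cover: "\<exists>a. c \<in> abs_circle ` J a" for c
  proof -
    obtain t where "c = abs_circle t"
      by (rule abs_circle_surj)
    \<comment> \<open>This choice puts \<open>t\<close> at the midpoint of the interval.\<close>
    then show ?thesis by (intro exI[of _ "t - pi"]) (auto simp: J_def)
  qed
  have smooth: "smooth_on (\<kappa> a ` (abs_circle ` J a \<inter> abs_circle ` J b))
      (\<kappa> b \<circ> inv_into (abs_circle ` J a) (\<kappa> a))" (is "smooth_on ?S ?f") for a b
  proof (rule smooth_on_constant_derivative)
    fix x assume "x \<in> ?S"
    then obtain s y where "x = \<kappa> a (abs_circle s)" "s \<in> J a" "y \<in> J b" "abs_circle s = abs_circle y"
      by blast
    then have x: "x \<in> J a" and y: "y \<in> J b" "abs_circle x = abs_circle y"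
      by (metis inv)+
    then obtain n :: int where n: "y = x + 2 * pi * of_int n" by (auto simp: abs_circle_eq_iff)
    \<comment> \<open>The integer \<open>n\<close> depends on \<open>x\<close>, since an overlap of
      two charts can have two components. On the neighborhood \<open>N\<close> the same
      \<open>n\<close> serves every point.\<close>
    define N where "N = J a \<inter> (\<lambda>s. s + 2 * pi * of_int n) -` J b"
    have "open N" unfolding N_def
      by (intro open_Int op open_vimage continuous_intros)
    moreover have "x \<in> N" using x y n by (simp add: N_def)
    moreover have "?f s = s + 2 * pi * of_int n" if "s \<in> N" for s
    proof -
      have "abs_circle s = abs_circle (s + 2 * pi * of_int n)"
        by (auto simp: abs_circle_eq_iff)
      with that show ?thesis by (simp add: N_def inv')
    qed
    moreover have "((\<lambda>s. s + 2 * pi * of_int n) has_derivative (\<lambda>v. v)) (at x)"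
      by (auto intro!: derivative_eq_intros)
    ultimately have "(?f has_derivative (\<lambda>v. v)) (at x)"
      by (intro has_derivative_transform_within_open[of _ _ x UNIV N ?f]) simp_all
    then show "(?f has_derivative (\<lambda>v. v)) (at x within ?S)"
      by (rule has_derivative_at_withinI)
  qed
  have charts: "circle_charts = range (\<lambda>a. (abs_circle ` J a, \<kappa> a))"
    by (auto simp: circle_charts_def J_def \<kappa>_def)
  show ?thesis
    unfolding smooth_atlas_def charts
    using cover homeo smooth op open_abs_circle_image[OF op] by auto
qed

section \<open>Orthogonal complements and the ideal\<close>

text \<open>The second condition captures the imaginary part, as
  \<open>Re (\<i> * z) = - Im z\<close>. Complex orthogonality thus becomes two real equations, to
  which continuity of \<open>inner\<close> applies.\<close>

lemma cinner_eq_0_iff: "cinner x y = 0 \<longleftrightarrow> inner x y = 0 \<and> inner (\<i> *\<^sub>C x) y = 0"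
  by (simp add: complex_eq_iff Re_cinner[symmetric] cinner_scaleC_left)

lemma cinner_add_right: "cinner x (y + z) = cinner x y + cinner x z"
  using cinner_add_left[of y z x] by (metis cinner_commute complex_cnj_add)

lemma cinner_scaleC_right: "cinner x (a *\<^sub>C y) = cnj a * cinner x y"
  using cinner_scaleC_left[of a y x] by (metis cinner_commute complex_cnj_mult)

lemma closed_csubspace_orthogonal_complement: "closed_csubspace (orthogonal_complement S)"
  unfolding closed_csubspace_def
proof (intro conjI)
  have "orthogonal_complement S = (\<Inter>\<eta>\<in>S. {\<xi>. inner \<eta> \<xi> = 0} \<inter> {\<xi>. inner (\<i> *\<^sub>C \<eta>) \<xi> = 0})"
    by (auto simp: orthogonal_complement_def cinner_eq_0_iff)
  then show "closed (orthogonal_complement S)"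
    by (auto intro!: closed_INT closed_Int closed_Collect_eq continuous_intros)
qed (auto simp: orthogonal_complement_def cinner_add_right cinner_scaleC_right cinner_eq_0_iff[of _ 0])

lemma has_sum_diff:
  fixes f g :: "'a \<Rightarrow> complex"
  assumes "(f has_sum a) A" "(g has_sum b) A"
  shows "((\<lambda>x. f x - g x) has_sum a - b) A"
  using has_sum_add[OF assms(1) has_sum_uminusI[OF assms(2)]] by simp

text \<open>The \<open>(m, n)\<close>-th coefficient of the product is \<open>q\<close>'s
  coefficient at \<open>(m - k, n)\<close> minus \<open>c\<close> times the one at
  \<open>(m, n)\<close>. Shifting the first sum by \<open>k\<close> moves the index change onto
  \<open>\<xi>\<close>, leaving the coefficients of \<open>q\<close> paired with the defect of a
  recursion.\<close>

lemma da_cinner_of_poly_mult: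
  "((\<lambda>(m, n). coeff (coeff q m) n * (of_real (da_weight (m + k, n)) * cnj (da_coeff \<xi> (m + k, n))
       - c * of_real (da_weight (m, n)) * cnj (da_coeff \<xi> (m, n))))
     has_sum cinner (da_of_poly (q * (monom 1 k - [:[:c:]:]))) \<xi>) UNIV"
proof -
  define Q where "Q m n = coeff (coeff q m) n" for m n
  define w where "w m n = of_real (da_weight (m, n)) * cnj (da_coeff \<xi> (m, n))" for m n
  define g where "g = (\<lambda>(m, n). if k \<le> m then Q (m - k) n * w m n else 0)"
  define h where "h = (\<lambda>(m, n). Q m n * (c * w m n))"
  define S where "S = (SIGMA m:{..degree q}. {..degree (coeff q m)})"
  have fin: "finite S" by (auto simp: S_def)
  have out: "Q (fst i) (snd i) = 0" if "i \<notin> S" for i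
    using that by (cases i) (auto simp: S_def Q_def coeff_eq_0 not_le)
  have hS: "(h has_sum (\<Sum>i\<in>S. h i)) UNIV"
    by (rule has_sum_finite_neutralI[OF fin]) (use out in \<open>auto simp: h_def\<close>)
  define g' where "g' = (\<lambda>(m, n). Q m n * w (m + k) n)"
  have g'S: "(g' has_sum (\<Sum>i\<in>S. g' i)) UNIV"
    by (rule has_sum_finite_neutralI[OF fin]) (use out in \<open>auto simp: g'_def\<close>)
  let ?s = "\<lambda>(m, n :: nat). (m + k, n)"
  have "inj ?s" by (auto simp: inj_on_def)
  moreover have "g \<circ> ?s = g'" by (auto simp: g_def g'_def fun_eq_iff)
  ultimately have "(g has_sum (\<Sum>i\<in>S. g' i)) (range ?s)"
    using g'S has_sum_reindex[of ?s UNIV g] by simp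
  \<comment> \<open>After reindexing, \<open>g\<close> is summed only over indices with first entry
    at least \<open>k\<close>; the others contribute 0, so the sum extends to all indices.\<close>
  moreover have "g i = 0" if "i \<notin> range ?s" for i
  proof (cases i)
    case (Pair m n)
    have "\<not> k \<le> m"
    proof
      assume "k \<le> m"
      then have "i = ?s (m - k, n)" using Pair by simp
      with that show False by blast
    qed
    then show ?thesis using Pair by (simp add: g_def)
  qed
  ultimately have gS: "(g has_sum (\<Sum>i\<in>S. g' i)) UNIV"
    using has_sum_cong_neutral[of UNIV "range ?s" g g] by auto
  have co: "coeff (coeff (q * (monom 1 k - [:[:c:]:])) m) n = (if k \<le> m then Q (m - k) n else 0) - c * Q m n"
    for m n
    by (auto simp: Q_def right_diff_distrib mult.commute[of q] coeff_monom_mult)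
  have "of_real (da_weight i) * (da_coeff (da_of_poly (q * (monom 1 k - [:[:c:]:]))) i * cnj (da_coeff \<xi> i))
      = g i - h i" for i
    by (cases i, simp only: da_coeff_of_poly co) (simp add: g_def h_def w_def algebra_simps)
  then have "cinner (da_of_poly (q * (monom 1 k - [:[:c:]:]))) \<xi> = (\<Sum>i\<in>S. g' i) - (\<Sum>i\<in>S. h i)"
    unfolding cinner_drury_arveson_def da_cinner_def
    using has_sum_diff[OF gS hS] by (simp add: infsumI)
  moreover have "((\<lambda>i. g' i - h i) has_sum (\<Sum>i\<in>S. g' i) - (\<Sum>i\<in>S. h i)) UNIV"
    by (rule has_sum_diff[OF g'S hS])
  moreover have "(\<lambda>i. g' i - h i) = (\<lambda>(m, n). coeff (coeff q m) n *
      (of_real (da_weight (m + k, n)) * cnj (da_coeff \<xi> (m + k, n))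
       - c * of_real (da_weight (m, n)) * cnj (da_coeff \<xi> (m, n))))"
    by (auto simp: fun_eq_iff g'_def h_def Q_def w_def algebra_simps)
  ultimately show ?thesis by simp
qed

text \<open>Testing against the monomial multiple \<open>q = z1^m z2^n\<close> of the generator
  isolates the defect \<open>r m n\<close>; conversely, vanishing defects kill every term of the
  sum. Conjugating \<open>r\<close> turns \<open>exp (\<i> * of_real t)\<close> into
  \<open>cis (- t)\<close>.\<close>

lemma ideal_perp_iff:
  "\<xi> \<in> ideal_perp k \<epsilon> t \<longleftrightarrow>
     (\<forall>m n. of_real (da_weight (m + k, n)) * da_coeff \<xi> (m + k, n)
        = of_real \<epsilon> * cis (- t) * of_real (da_weight (m, n)) * da_coeff \<xi> (m, n))"
proof -
  define c where "c = of_real \<epsilon> * exp (\<i> * of_real t)"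
  define r where "r m n = of_real (da_weight (m + k, n)) * cnj (da_coeff \<xi> (m + k, n))
       - c * of_real (da_weight (m, n)) * cnj (da_coeff \<xi> (m, n))" for m n
  have sum: "((\<lambda>(m, n). coeff (coeff q m) n * r m n)
     has_sum cinner (da_of_poly (q * (monom 1 k - [:[:c:]:]))) \<xi>) UNIV" for q
    unfolding r_def by (rule da_cinner_of_poly_mult)
  have "\<xi> \<in> ideal_perp k \<epsilon> t \<longleftrightarrow> (\<forall>q. cinner (da_of_poly (q * (monom 1 k - [:[:c:]:]))) \<xi> = 0)"
    by (auto simp: ideal_perp_def orthogonal_complement_def ideal_I_def principal_ideal_def c_def)
  also have "\<dots> \<longleftrightarrow> (\<forall>m n. r m n = 0)"
  proof safe
    fix m n assume 0: "\<forall>q. cinner (da_of_poly (q * (monom 1 k - [:[:c:]:]))) \<xi> = 0"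
    let ?q = "monom (monom 1 n) m :: complex poly poly"
    have "((\<lambda>(m, n). coeff (coeff ?q m) n * r m n) has_sum r m n) UNIV"
      by (rule has_sum_finite_neutralI[of "{(m, n)}"]) (auto split: if_splits)
    then show "r m n = 0"
      using has_sum_unique[OF _ sum[of ?q]] 0 by simp
  next
    fix q assume "\<forall>m n. r m n = 0"
    then show "cinner (da_of_poly (q * (monom 1 k - [:[:c:]:]))) \<xi> = 0"
      using has_sum_unique[OF sum[of q] has_sum_0] by auto
  qed
  finally have *: "\<xi> \<in> ideal_perp k \<epsilon> t \<longleftrightarrow> (\<forall>m n. r m n = 0)" .
  have eq: "r m n = 0 \<longleftrightarrow> of_real (da_weight (m + k, n)) * da_coeff \<xi> (m + k, n)
        = of_real \<epsilon> * cis (- t) * of_real (da_weight (m, n)) * da_coeff \<xi> (m, n)" for m n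
  proof -
    have "r m n = 0 \<longleftrightarrow> cnj (r m n) = 0" by simp
    also have "cnj (r m n) = of_real (da_weight (m + k, n)) * da_coeff \<xi> (m + k, n)
        - of_real \<epsilon> * cis (- t) * of_real (da_weight (m, n)) * da_coeff \<xi> (m, n)"
      by (simp add: r_def c_def cis_conv_exp exp_cnj)
    finally show ?thesis by simp
  qed
  show ?thesis unfolding * eq ..
qed

section \<open>Diagonal unitaries\<close>

text \<open>The parameter is a complex number instead of an angle, so that the operator makes sense
  over the circle as well. It is meant for \<open>cmod z = 1\<close>, where the rescaled sequence
  stays in \<open>da_seq\<close>.\<close>

definition block_rotation :: "nat \<Rightarrow> complex \<Rightarrow> drury_arveson \<Rightarrow> drury_arveson" where
  "block_rotation k z f = Abs_da (da_fun (\<lambda>i. z ^ (fst i div k) * da_coeff f i))"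

lemma da_coeff_block_rotation:
  assumes "cmod z = 1"
  shows "da_coeff (block_rotation k z f) i = z ^ (fst i div k) * da_coeff f i"
proof -
  have mem: "(\<lambda>i. z ^ (fst i div k) * da_coeff f i) \<in> da_seq"
    by (rule da_seq_bound[OF _ da_coeff_mem[of f] da_coeff_mem[of f], of 1])
      (simp_all add: assms norm_mult norm_power)
  have "da_coeff (block_rotation k z f) = (\<lambda>i. z ^ (fst i div k) * da_coeff f i)"
    by (rule da_coeff_eqI[OF mem]) (use mem in \<open>simp add: block_rotation_def Abs_da_inverse\<close>)
  then show ?thesis by simp
qed

lemma block_rotation_linear:
  assumes "cmod z = 1"
  shows "block_rotation k z (a *\<^sub>C f + g) = a *\<^sub>C block_rotation k z f + block_rotation k z g"
  by (rule da_eqI)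
    (simp add: da_coeff_block_rotation[OF assms] da_coeff_add da_coeff_scaleC algebra_simps)

text \<open>On the unit circle \<open>cnj z\<close> is the inverse of \<open>z\<close>, so the
  inverse operator is again a block rotation.\<close>

lemma block_rotation_cnj:
  assumes "cmod z = 1"
  shows "block_rotation k (cnj z) (block_rotation k z f) = f"
proof (rule da_eqI)
  fix i
  have "cnj z * z = 1"
    using assms by (simp add: mult.commute complex_norm_square[symmetric])
  then show "da_coeff (block_rotation k (cnj z) (block_rotation k z f)) i = da_coeff f i"
    by (simp add: da_coeff_block_rotation assms mult.assoc[symmetric] power_mult_distrib[symmetric])
qed

lemma norm_block_rotation_diff:
  assumes "cmod z = 1"
  shows "norm (block_rotation k z f - block_rotation k z g) = norm (f - g)"
proof -
  have "(norm (block_rotation k z f - block_rotation k z g))\<^sup>2 = (norm (f - g))\<^sup>2"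
    unfolding da_norm_square da_coeff_diff da_coeff_block_rotation[OF assms]
    by (simp add: right_diff_distrib[symmetric] norm_mult norm_power assms)
  then show ?thesis by (simp add: power2_eq_iff_nonneg)
qed

text \<open>The squared norm of the difference is a series of functions continuous in
  \<open>w\<close>, dominated on the unit circle by a summable series. The bound depends on
  \<open>f\<close>: this is strong continuity only.\<close>

lemma tendsto_block_rotation:
  assumes z: "cmod z = 1"
  shows "((\<lambda>w. block_rotation k w f) \<longlongrightarrow> block_rotation k z f) (at z within sphere 0 1)"
proof -
  define h where "h i w = da_weight i * (cmod (w ^ (fst i div k) * da_coeff f i - z ^ (fst i div k) * da_coeff f i))\<^sup>2"
    for i w
  have "uniform_limit (sphere 0 1) (\<lambda>F w. \<Sum>i\<in>F. h i w) (\<lambda>w. \<Sum>\<^sub>\<infinity>i. h i w) (finite_subsets_at_top UNIV)"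
  proof (rule Weierstrass_m_test_general)
    show "(\<lambda>i. 4 * (da_weight i * (cmod (da_coeff f i))\<^sup>2)) summable_on UNIV"
      \<comment> \<open>The factor 4 comes from \<open>power2_cmod_add_le\<close>: both summands
        have the modulus of \<open>da_coeff f i\<close>.\<close>
      using da_coeff_mem[of f] by (intro summable_on_cmult_right) (simp add: da_seq_def)
    fix i and w :: complex assume "w \<in> sphere 0 1"
    then have w: "cmod w = 1" by simp
    have "(cmod (w ^ (fst i div k) * da_coeff f i - z ^ (fst i div k) * da_coeff f i))\<^sup>2
      \<le> 4 * (cmod (da_coeff f i))\<^sup>2"
      using power2_cmod_add_le[of "w ^ (fst i div k) * da_coeff f i" "- (z ^ (fst i div k) * da_coeff f i)"]
      by (simp add: norm_mult norm_power w z)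
    from mult_left_mono[OF this, of "da_weight i"]
    show "norm (h i w) \<le> 4 * (da_weight i * (cmod (da_coeff f i))\<^sup>2)"
      using da_weight_pos[of i] by (simp add: h_def algebra_simps)
  qed
  then have "continuous_on (sphere 0 1) (\<lambda>w. \<Sum>\<^sub>\<infinity>i. h i w)"
    by (rule uniform_limit_theorem[rotated])
      (auto simp: h_def intro!: always_eventually continuous_intros)
  then have "((\<lambda>w. \<Sum>\<^sub>\<infinity>i. h i w) \<longlongrightarrow> (\<Sum>\<^sub>\<infinity>i. h i z)) (at z within sphere 0 1)"
    using z by (auto simp: continuous_on_def)
  then have "((\<lambda>w. sqrt (\<Sum>\<^sub>\<infinity>i. h i w)) \<longlongrightarrow> sqrt 0) (at z within sphere 0 1)"
    by (intro tendsto_real_sqrt) (simp add: h_def)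
  moreover have "sqrt (\<Sum>\<^sub>\<infinity>i. h i w) = norm (block_rotation k w f - block_rotation k z f)"
    if "cmod w = 1" for w
    using da_norm_square[of "block_rotation k w f - block_rotation k z f"]
    unfolding da_coeff_diff da_coeff_block_rotation[OF that] da_coeff_block_rotation[OF z]
    by (simp add: h_def real_sqrt_unique)
  then have "\<forall>\<^sub>F w in at z within sphere 0 1.
      sqrt (\<Sum>\<^sub>\<infinity>i. h i w) = norm (block_rotation k w f - block_rotation k z f)"
    unfolding eventually_at_filter by (intro always_eventually) auto
  ultimately have "((\<lambda>w. norm (block_rotation k w f - block_rotation k z f)) \<longlongrightarrow> sqrt 0)
      (at z within sphere 0 1)"
    by (rule Lim_transform_eventually)
  then show ?thesis
    by (simp only: real_sqrt_zero tendsto_norm_zero_iff LIM_zero_iff)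
qed

text \<open>Rotating \<open>g\<close> by \<open>w\<close> gives the rotation of \<open>f\<close> by
  \<open>w\<close> plus a difference of norm \<open>norm (g - f)\<close>, by isometry. The first
  part converges by strong continuity, the second to 0.\<close>

lemma continuous_on_block_rotation:
  "continuous_on (sphere 0 1 \<times> UNIV) (\<lambda>e. block_rotation k (fst e) (snd e))"
  unfolding continuous_on_def
proof safe
  fix z :: complex and f :: drury_arveson assume "z \<in> sphere 0 1"
  then have z: "cmod z = 1" by simp
  let ?N = "at (z, f) within sphere 0 1 \<times> UNIV"
  have "continuous_on (sphere 0 1) (\<lambda>w. block_rotation k w f)"
    using tendsto_block_rotation by (auto simp: continuous_on_def)
  then have "continuous_on (sphere 0 1 \<times> UNIV) (\<lambda>e. block_rotation k (fst e) f)"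
    by (rule continuous_on_compose2) (auto intro!: continuous_intros)
  then have "((\<lambda>e. block_rotation k (fst e) f) \<longlongrightarrow> block_rotation k z f) ?N"
    using z by (auto simp: continuous_on_def)
  moreover have "((\<lambda>e. block_rotation k (fst e) (snd e) - block_rotation k (fst e) f) \<longlongrightarrow> 0) ?N"
  proof (rule tendsto_norm_zero_cancel)
    have "((\<lambda>e. norm (snd e - f)) \<longlongrightarrow> norm (snd (z, f) - f)) ?N"
      by (intro tendsto_intros)
    moreover have "\<forall>\<^sub>F e in ?N. norm (snd e - f)
        = norm (block_rotation k (fst e) (snd e) - block_rotation k (fst e) f)"
      unfolding eventually_at_filter
      by (rule always_eventually) (auto simp: norm_block_rotation_diff)
    ultimately show "((\<lambda>e. norm (block_rotation k (fst e) (snd e) - block_rotation k (fst e) f)) \<longlongrightarrow> 0) ?N"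
      by (auto intro: Lim_transform_eventually)
  qed
  ultimately have "((\<lambda>e. block_rotation k (fst e) f
      + (block_rotation k (fst e) (snd e) - block_rotation k (fst e) f)) \<longlongrightarrow> block_rotation k z f + 0) ?N"
    by (rule tendsto_add)
  then show "((\<lambda>e. block_rotation k (fst e) (snd e))
      \<longlongrightarrow> block_rotation k (fst (z, f)) (snd (z, f))) ?N"
    by simp
qed

text \<open>Raising \<open>m\<close> by \<open>k\<close> raises \<open>m div k\<close> by exactly
  one. The left side of the recursion thereby gains one factor \<open>cis t\<close>, which absorbs
  the \<open>cis (- t)\<close> on the right.\<close>

lemma block_rotation_mem_ideal_perp_iff:
  assumes k: "k \<ge> 1"
  shows "block_rotation k (cis t) \<xi> \<in> ideal_perp k \<epsilon> 0 \<longleftrightarrow> \<xi> \<in> ideal_perp k \<epsilon> t"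
  unfolding ideal_perp_iff
proof (intro iff_allI)
  fix m n
  define w where "w = cis t ^ (m div k)"
  have w: "w \<noteq> 0" by (simp add: w_def)
  let ?a = "of_real (da_weight (m + k, n)) * da_coeff \<xi> (m + k, n)"
  let ?b = "of_real \<epsilon> * of_real (da_weight (m, n)) * da_coeff \<xi> (m, n)"
  have "(m + k) div k = Suc (m div k)" using k by simp
  then have "of_real (da_weight (m + k, n)) * da_coeff (block_rotation k (cis t) \<xi>) (m + k, n)
        = of_real \<epsilon> * cis (- 0) * of_real (da_weight (m, n)) * da_coeff (block_rotation k (cis t) \<xi>) (m, n)
     \<longleftrightarrow> w * (cis t * ?a) = w * ?b"
    by (simp add: da_coeff_block_rotation w_def[symmetric] mult_ac)
  also have "\<dots> \<longleftrightarrow> cis t * ?a = ?b" using w by simp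
  also have "\<dots> \<longleftrightarrow> cis (- t) * (cis t * ?a) = cis (- t) * ?b" by simp
  also have "cis (- t) * (cis t * ?a) = ?a"
    by (simp add: mult.assoc[symmetric] cis_mult)
  also have "cis (- t) * ?b = of_real \<epsilon> * cis (- t) * of_real (da_weight (m, n)) * da_coeff \<xi> (m, n)"
    by (simp add: mult_ac)
  finally show "of_real (da_weight (m + k, n)) * da_coeff (block_rotation k (cis t) \<xi>) (m + k, n)
        = of_real \<epsilon> * cis (- 0) * of_real (da_weight (m, n)) * da_coeff (block_rotation k (cis t) \<xi>) (m, n)
     \<longleftrightarrow> ?a = of_real \<epsilon> * cis (- t) * of_real (da_weight (m, n)) * da_coeff \<xi> (m, n)" .
qed

section \<open>The bundles over the line and the circle\<close>

text \<open>Both bases are handled at once through a unimodular function \<open>u\<close>: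
  \<open>cis\<close> on the line and its descent \<open>circle_cis\<close> on the circle.\<close>

lemma smooth_hilbert_bundle_block_rotation:
  fixes C :: "('b::topological_space, 'm::real_normed_vector) chart set"
  assumes C: "smooth_atlas C" and u: "continuous_on UNIV u" "\<And>b. cmod (u b) = 1"
    and E: "\<And>b \<xi>. (b, \<xi>) \<in> E \<longleftrightarrow> block_rotation k (u b) \<xi> \<in> ideal_perp k \<epsilon> 0"
  shows "smooth_hilbert_bundle C (top_of_set E) fst snd"
proof (rule smooth_hilbert_bundle_trivialI[OF C, where F = "ideal_perp k \<epsilon> 0"
      and V = "\<lambda>b. block_rotation k (cnj (u b))" and W = "\<lambda>b. block_rotation k (u b)"])
  show "closed_csubspace (ideal_perp k \<epsilon> 0)"
    unfolding ideal_perp_def by (rule closed_csubspace_orthogonal_complement)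
  \<comment> \<open>A general \<open>v\<close> is used because the claim is needed for
    \<open>u\<close> and for its conjugate.\<close>
  have cont: "continuous_on UNIV (\<lambda>e :: 'b \<times> drury_arveson. block_rotation k (v (fst e)) (snd e))"
    if "continuous_on UNIV v" "\<And>b. cmod (v b) = 1" for v
  proof -
    have "continuous_on UNIV (\<lambda>e :: 'b \<times> drury_arveson. v (fst e))"
      by (rule continuous_on_compose2[OF that(1)]) (auto intro: continuous_on_fst)
    then have "continuous_on UNIV (\<lambda>e :: 'b \<times> drury_arveson. (v (fst e), snd e))"
      by (intro continuous_on_Pair continuous_on_snd continuous_on_id)
    from continuous_on_compose2[OF continuous_on_block_rotation this] that(2)
    show ?thesis by (auto simp: image_subset_iff)
  qed
  show "continuous_on UNIV (\<lambda>e. block_rotation k (u (fst e)) (snd e))"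
    by (rule cont[OF u])
  show "continuous_on UNIV (\<lambda>e. block_rotation k (cnj (u (fst e))) (snd e))"
    by (rule cont[where v = "\<lambda>b. cnj (u b)"]) (auto intro!: continuous_intros u simp: u)
  show "block_rotation k (u b) (block_rotation k (cnj (u b)) x) = x" for b x
    using block_rotation_cnj[of "cnj (u b)"] u(2) by simp
  show "block_rotation k (cnj (u b)) (block_rotation k (u b) x) = x" for b x
    by (rule block_rotation_cnj[OF u(2)])
  show "block_rotation k (u b) (a *\<^sub>C x + y) = a *\<^sub>C block_rotation k (u b) x + block_rotation k (u b) y"
    for b a x y
    by (rule block_rotation_linear[OF u(2)])
qed (rule E)

lift_definition circle_cis :: "circle \<Rightarrow> complex" is cis
proof -
  fix s t assume "circle_rel s t"
  then obtain n :: int where "t = s + 2 * pi * of_int n" by (auto simp: circle_rel_def)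
  then show "cis s = cis t"
    by (simp add: cis_mult[symmetric] cis_multiple_2pi)
qed

theorem theorem2p3:
  fixes k :: nat and \<epsilon> :: real
  assumes "k \<ge> 1" and "0 < \<epsilon>" and "\<epsilon> < 1"
  shows "smooth_hilbert_bundle line_charts
           (top_of_set {(t, \<xi>) | t \<xi>. \<xi> \<in> ideal_perp k \<epsilon> t}) fst snd
       \<and> (\<forall>t. ideal_I k \<epsilon> (t + 2 * pi) = ideal_I k \<epsilon> t)
       \<and> smooth_hilbert_bundle circle_charts
           (top_of_set {(abs_circle t, \<xi>) | t \<xi>. \<xi> \<in> ideal_perp k \<epsilon> t}) fst snd"
proof (intro conjI allI)
  note mem = block_rotation_mem_ideal_perp_iff[OF assms(1)]
  show "smooth_hilbert_bundle line_charts (top_of_set {(t, \<xi>) | t \<xi>. \<xi> \<in> ideal_perp k \<epsilon> t}) fst snd"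
    by (rule smooth_hilbert_bundle_block_rotation[OF smooth_atlas_line_charts, of cis _ k \<epsilon>])
      (auto simp: mem intro!: continuous_intros)
  show "ideal_I k \<epsilon> (t + 2 * pi) = ideal_I k \<epsilon> t" for t
  proof -
    have "cis (t + 2 * pi) = cis t" by (simp add: cis_mult[symmetric])
    then show ?thesis by (simp only: ideal_I_def cis_conv_exp)
  qed
  show "smooth_hilbert_bundle circle_charts
      (top_of_set {(abs_circle t, \<xi>) | t \<xi>. \<xi> \<in> ideal_perp k \<epsilon> t}) fst snd"
  proof (rule smooth_hilbert_bundle_block_rotation[OF smooth_atlas_circle_charts, of circle_cis _ k \<epsilon>])
    show "continuous_on UNIV circle_cis"
      by (rule continuous_on_circle) (auto simp: circle_cis.abs_eq intro!: continuous_intros)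
    show "cmod (circle_cis b) = 1" for b
      by transfer simp
    show "(b, \<xi>) \<in> {(abs_circle t, \<xi>) | t \<xi>. \<xi> \<in> ideal_perp k \<epsilon> t}
        \<longleftrightarrow> block_rotation k (circle_cis b) \<xi> \<in> ideal_perp k \<epsilon> 0" for b \<xi>
    proof
      assume "(b, \<xi>) \<in> {(abs_circle t, \<xi>) | t \<xi>. \<xi> \<in> ideal_perp k \<epsilon> t}"
      then show "block_rotation k (circle_cis b) \<xi> \<in> ideal_perp k \<epsilon> 0"
        by (auto simp: circle_cis.abs_eq mem)
    next
      assume *: "block_rotation k (circle_cis b) \<xi> \<in> ideal_perp k \<epsilon> 0"
      \<comment> \<open>Any representative will do, as \<open>circle_cis b = cis t\<close> and
        \<open>mem\<close> then puts \<open>\<xi>\<close> into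
        \<open>ideal_perp k \<epsilon> t\<close>.\<close>
      obtain t where "b = abs_circle t"
        by (rule abs_circle_surj)
      with * show "(b, \<xi>) \<in> {(abs_circle t, \<xi>) | t \<xi>. \<xi> \<in> ideal_perp k \<epsilon> t}"
        by (auto simp: circle_cis.abs_eq mem)
    qed
  qed
qed

end
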